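(* Let $n\ge 2$ and let $K$ be a compact group with a given continuous orthogonal representation on $\mathbf{R}^n$ such that the action of $K$ on the unit sphere of $\mathbf{R}^n$ is transitive (e.g. $K=\mathrm{SO}(n)$, or $K=\mathrm{SU}(m)$ with $2m=n\ge 4$). Then the semidirect product $G=\mathbf{R}^n\rtimes K$ has strong Property PL; that is, every semigroup length on $G$ is either bounded or proper.
   Context: A semigroup length on a locally compact group $G$ is a function $L:G\to[0,\infty[$ which is bounded on compact subsets of $G$ and satisfies $L(xy)\le L(x)+L(y)$ for all $x,y\in G$ (no continuity is assumed, and $L(1)=0$ is not required). It is proper if $L^{-1}([0,n])$ has compact closure in $G$ for every $n<\infty$. The semidirect product is taken with respect to the given representation of $K$ on $\mathbf{R}^n$, with the product topology. *)

theory Defs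
  imports "HOL-Analysis.Analysis" "HOL-Algebra.Group"
begin

text \<open>The topology lives on the carrier only. No Hausdorff assumption is made, so
  ``compact group'' covers both conventions.\<close>

locale topological_group = group G for G (structure) +
  fixes T :: "'a topology"
  assumes topspace_eq: "topspace T = carrier G"
    and continuous_mult: "continuous_map (prod_topology T T) T (\<lambda>(x, y). x \<otimes> y)"
    and continuous_inv: "continuous_map T T (\<lambda>x. inv x)"

locale locally_compact_group = topological_group +
  assumes locally_compact: "locally_compact_space T"

locale compact_group = topological_group +
  assumes compact: "compact_space T"

text \<open>Lengths are total functions on the ambient type; only their values on the carrier matter.\<close>

definition semigroup_length :: "('a, 'm) monoid_scheme \<Rightarrow> 'a topology \<Rightarrow> ('a \<Rightarrow> real) \<Rightarrow> bool" where
  "semigroup_length G T L \<longleftrightarrow>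
     (\<forall>x\<in>carrier G. 0 \<le> L x) \<and>
     (\<forall>C. compactin T C \<longrightarrow> bounded (L ` C)) \<and>
     (\<forall>x\<in>carrier G. \<forall>y\<in>carrier G. L (x \<otimes>\<^bsub>G\<^esub> y) \<le> L x + L y)"

definition bounded_length :: "('a, 'm) monoid_scheme \<Rightarrow> ('a \<Rightarrow> real) \<Rightarrow> bool" where
  "bounded_length G L \<longleftrightarrow> bounded (L ` carrier G)"

text \<open>The closure is written in prefix form because HOL-Algebra reuses the infix notation.\<close>

definition proper_length :: "('a, 'm) monoid_scheme \<Rightarrow> 'a topology \<Rightarrow> ('a \<Rightarrow> real) \<Rightarrow> bool" where
  "proper_length G T L \<longleftrightarrow>
     (\<forall>r::real. compactin T (Abstract_Topology.closure_of T {x \<in> carrier G. L x \<in> {0..r}}))"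

definition strong_property_PL :: "('a, 'm) monoid_scheme \<Rightarrow> 'a topology \<Rightarrow> bool" where
  "strong_property_PL G T \<longleftrightarrow>
     (\<forall>L. semigroup_length G T L \<longrightarrow> bounded_length G L \<or> proper_length G T L)"

definition orthogonal_group :: "(real^'n^'n) monoid" where
  "orthogonal_group = \<lparr>carrier = {A. orthogonal_matrix A}, mult = (**), one = mat 1\<rparr>"

text \<open>A continuous orthogonal representation on Euclidean space is a continuous homomorphism to
  the orthogonal group, whose topology is induced from that of the space of matrices.\<close>

definition continuous_orthogonal_rep ::
    "('k, 'm) monoid_scheme \<Rightarrow> 'k topology \<Rightarrow> ('k \<Rightarrow> real^'n^'n) \<Rightarrow> bool" where
  "continuous_orthogonal_rep K T \<rho> \<longleftrightarrow>
     \<rho> \<in> hom K orthogonal_group \<and>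
     continuous_map T (top_of_set (carrier orthogonal_group)) \<rho>"

definition transitive_on_sphere ::
    "('k, 'm) monoid_scheme \<Rightarrow> ('k \<Rightarrow> real^'n^'n) \<Rightarrow> bool" where
  "transitive_on_sphere K \<rho> \<longleftrightarrow>
     (\<forall>u\<in>sphere 0 1. \<forall>v\<in>sphere 0 1. \<exists>k\<in>carrier K. \<rho> k *v u = v)"

definition semidirect :: "('k, 'm) monoid_scheme \<Rightarrow> ('k \<Rightarrow> real^'n^'n) \<Rightarrow> ((real^'n) \<times> 'k) monoid" where
  "semidirect K \<rho> =
     \<lparr>carrier = UNIV \<times> carrier K,
      mult = (\<lambda>(v, g) (w, h). (v + \<rho> g *v w, g \<otimes>\<^bsub>K\<^esub> h)),
      one = (0, \<one>\<^bsub>K\<^esub>)\<rparr>"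

definition semidirect_topology :: "'k topology \<Rightarrow> ((real^'n) \<times> 'k) topology" where
  "semidirect_topology T = prod_topology euclidean T"

text \<open>The semidirect product is indeed a locally compact group.\<close>

lemma continuous_map_matrix_vector_mult:
  fixes A :: "'a \<Rightarrow> real^'n^'m" and f :: "'a \<Rightarrow> real^'n"
  assumes "continuous_map X euclidean A" "continuous_map X euclidean f"
  shows "continuous_map X euclidean (\<lambda>x. A x *v f x)"
proof -
  have "continuous_on UNIV (\<lambda>p :: (real^'n^'m) \<times> (real^'n). fst p *v snd p)"
    unfolding matrix_vector_mult_def by (intro continuous_intros)
  then have "continuous_map euclidean euclidean (\<lambda>p :: (real^'n^'m) \<times> (real^'n). fst p *v snd p)"
    by simp
  moreover have "continuous_map X euclidean (\<lambda>x. (A x, f x))"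
    using continuous_map_pairedI[OF assms] by simp
  ultimately have "continuous_map X euclidean
      ((\<lambda>p. fst p *v snd p) \<circ> (\<lambda>x. (A x, f x)))"
    by (intro continuous_map_compose)
  then show ?thesis
    by (simp only: o_def fst_conv snd_conv)
qed

lemma locally_compact_group_semidirect:
  fixes K (structure) and \<rho> :: "'k \<Rightarrow> real^'n^'n"
  assumes K: "compact_group K T" and \<rho>: "continuous_orthogonal_rep K T \<rho>"
  shows "locally_compact_group (semidirect K \<rho>) (semidirect_topology T)"
proof -
  interpret compact_group K T by (rule K)
  have orth: "orthogonal_matrix (\<rho> k)" if "k \<in> carrier K" for k
    using \<rho> that by (auto simp: continuous_orthogonal_rep_def hom_def orthogonal_group_def)
  have \<rho>_mult: "\<rho> (k \<otimes> l) = \<rho> k ** \<rho> l" if "k \<in> carrier K" "l \<in> carrier K" for k l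
    using \<rho> that by (auto simp: continuous_orthogonal_rep_def hom_def orthogonal_group_def)
  have \<rho>_one: "\<rho> \<one> = mat 1"
  proof -
    have "\<rho> \<one> ** \<rho> \<one> = \<rho> \<one>"
      using \<rho>_mult[of \<one> \<one>] by simp
    then have "transpose (\<rho> \<one>) ** (\<rho> \<one> ** \<rho> \<one>) = transpose (\<rho> \<one>) ** \<rho> \<one>"
      by simp
    then show ?thesis
      using orth[OF one_closed] by (simp add: matrix_mul_assoc orthogonal_matrix_def)
  qed
  have \<rho>_cont: "continuous_map T euclidean \<rho>"
    using \<rho> by (auto simp: continuous_orthogonal_rep_def continuous_map_in_subtopology)
  have grp: "group (semidirect K \<rho>)"
  proof (rule groupI)
    fix x y z
    assume "x \<in> carrier (semidirect K \<rho>)" "y \<in> carrier (semidirect K \<rho>)"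
      "z \<in> carrier (semidirect K \<rho>)"
    then obtain u g v h w k where "x = (u, g)" "y = (v, h)" "z = (w, k)"
      and "g \<in> carrier K" "h \<in> carrier K" "k \<in> carrier K"
      by (auto simp: semidirect_def)
    then show "x \<otimes>\<^bsub>semidirect K \<rho>\<^esub> y \<otimes>\<^bsub>semidirect K \<rho>\<^esub> z =
        x \<otimes>\<^bsub>semidirect K \<rho>\<^esub> (y \<otimes>\<^bsub>semidirect K \<rho>\<^esub> z)"
      by (simp add: semidirect_def m_assoc \<rho>_mult matrix_vector_right_distrib
          matrix_vector_mul_assoc add.assoc)
  next
    fix x assume x: "x \<in> carrier (semidirect K \<rho>)"
    then show "\<exists>y\<in>carrier (semidirect K \<rho>). y \<otimes>\<^bsub>semidirect K \<rho>\<^esub> x = \<one>\<^bsub>semidirect K \<rho>\<^esub>"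
      by (intro bexI[of _ "(- (\<rho> (inv (snd x)) *v fst x), inv (snd x))"])
        (auto simp: semidirect_def)
  qed (auto simp: semidirect_def \<rho>_one)
  interpret G: group "semidirect K \<rho>" by (rule grp)
  let ?T = "semidirect_topology T :: ((real^'n) \<times> 'k) topology"
  have top: "topspace ?T = carrier (semidirect K \<rho>)"
    by (simp add: semidirect_topology_def semidirect_def topspace_eq)
  have inv_eq: "inv\<^bsub>semidirect K \<rho>\<^esub> x = (- (\<rho> (inv (snd x)) *v fst x), inv (snd x))"
    if "x \<in> topspace ?T" for x
  proof (rule G.inv_equality)
    have x: "snd x \<in> carrier K"
      using that unfolding top by (auto simp: semidirect_def)
    show "(- (\<rho> (inv (snd x)) *v fst x), inv (snd x)) \<otimes>\<^bsub>semidirect K \<rho>\<^esub> x = \<one>\<^bsub>semidirect K \<rho>\<^esub>"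
      using x by (cases x) (simp add: semidirect_def)
    show "x \<in> carrier (semidirect K \<rho>)"
      using that unfolding top .
    show "(- (\<rho> (inv (snd x)) *v fst x), inv (snd x)) \<in> carrier (semidirect K \<rho>)"
      using x by (simp add: semidirect_def)
  qed
  have fst: "continuous_map ?T euclidean fst" and snd: "continuous_map ?T T snd"
    by (simp_all add: semidirect_topology_def continuous_map_fst continuous_map_snd)
  have inv_snd: "continuous_map ?T T (\<lambda>x. inv (snd x))"
    using continuous_map_compose[OF snd continuous_inv] by (simp add: o_def)
  have "continuous_map ?T ?T (\<lambda>x. (- (\<rho> (inv (snd x)) *v fst x), inv (snd x)))"
    unfolding semidirect_topology_def
    using inv_snd fst continuous_map_compose[OF inv_snd \<rho>_cont]
    by (intro continuous_map_pairedI continuous_map_minus continuous_map_matrix_vector_mult)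
      (auto simp: o_def semidirect_topology_def)
  then have inv: "continuous_map ?T ?T (\<lambda>x. inv\<^bsub>semidirect K \<rho>\<^esub> x)"
    by (rule continuous_map_eq) (simp add: inv_eq)
  let ?P = "prod_topology ?T ?T"
  have f: "continuous_map ?P ?T fst" and s: "continuous_map ?P ?T snd"
    by (simp_all add: continuous_map_fst continuous_map_snd)
  have ff: "continuous_map ?P euclidean (\<lambda>p. fst (fst p))"
    and sf: "continuous_map ?P T (\<lambda>p. snd (fst p))"
    and fs: "continuous_map ?P euclidean (\<lambda>p. fst (snd p))"
    and ss: "continuous_map ?P T (\<lambda>p. snd (snd p))"
    using continuous_map_compose[OF f fst] continuous_map_compose[OF f snd]
      continuous_map_compose[OF s fst] continuous_map_compose[OF s snd] by (simp_all add: o_def)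
  have "continuous_map ?P T (\<lambda>p. snd (fst p) \<otimes> snd (snd p))"
    using continuous_map_compose[OF continuous_map_pairedI[OF sf ss] continuous_mult]
    by (simp add: o_def)
  moreover have "continuous_map ?P euclidean (\<lambda>p. fst (fst p) + \<rho> (snd (fst p)) *v fst (snd p))"
    using ff fs continuous_map_compose[OF sf \<rho>_cont]
    by (intro continuous_map_add continuous_map_matrix_vector_mult) (auto simp: o_def)
  ultimately have "continuous_map ?P (prod_topology euclidean T)
      (\<lambda>p. (fst (fst p) + \<rho> (snd (fst p)) *v fst (snd p), snd (fst p) \<otimes> snd (snd p)))"
    by (intro continuous_map_pairedI)
  then have mult: "continuous_map ?P ?T (\<lambda>(x, y). x \<otimes>\<^bsub>semidirect K \<rho>\<^esub> y)"
    by (simp add: semidirect_def semidirect_topology_def case_prod_unfold)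
  have "locally_compact_space T"
    using compact by (rule compact_imp_locally_compact_space)
  then have "locally_compact_space ?T"
    by (simp add: semidirect_topology_def locally_compact_space_prod_topology
        locally_compact_space_euclidean)
  then show ?thesis
    using top inv mult by unfold_locales
qed

end

theory Submission
  imports Defs
begin

text \<open>Conjugating by the compact group shows that, up to a bounded error, \<open>L (v, g)\<close> depends only
  on the norm of \<open>v\<close>. If \<open>L\<close> is not proper, then it is at most a constant on spheres of
  arbitrarily large radius \<open>s\<close>; as \<open>n \<ge> 2\<close>, every vector of norm at most \<open>2 s\<close> is
  the sum of two vectors of norm \<open>s\<close>, so subadditivity makes \<open>L\<close> bounded.\<close>

text \<open>Take \<open>u\<close> and \<open>v\<close> to be \<open>w / 2\<close> plus and minus a
  vector \<open>z\<close> orthogonal to \<open>w\<close>; Pythagoras fixes the length of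
  \<open>z\<close>, and dimension at least 2 supplies its direction.\<close>

lemma sum_of_two_vectors_of_norm:
  fixes w :: "'a::euclidean_space"
  assumes dim: "2 \<le> DIM('a)" and w: "norm w \<le> 2 * s"
  obtains u v where "w = u + v" "norm u = s" "norm v = s"
proof -
  obtain y where y: "y \<noteq> 0" "orthogonal w y"
    using orthogonal_to_vector_exists[OF dim] by blast
  define t where "t = sqrt (s\<^sup>2 - (norm w / 2)\<^sup>2)"
  define z where "z = (t / norm y) *\<^sub>R y"
  have s: "0 \<le> s"
    using w norm_ge_zero[of w] by linarith
  \<comment> \<open>The bound on \<open>norm w\<close> makes the radicand in \<open>t\<close>
    nonnegative, so squaring undoes the root.\<close>
  have "(norm w / 2)\<^sup>2 \<le> s\<^sup>2"
    using w by (intro power_mono) auto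
  then have "(norm z)\<^sup>2 = s\<^sup>2 - (norm w / 2)\<^sup>2"
    using y(1) by (simp add: z_def t_def)
  moreover have orth: "orthogonal ((1/2) *\<^sub>R w) z"
    using y(2) by (simp add: z_def orthogonal_def)
  ultimately have sq: "(norm ((1/2) *\<^sub>R w + z))\<^sup>2 = s\<^sup>2" "(norm ((1/2) *\<^sub>R w + - z))\<^sup>2 = s\<^sup>2"
    using norm_add_Pythagorean[OF orth] norm_add_Pythagorean[of "(1/2) *\<^sub>R w" "- z"]
    by (simp_all add: orthogonal_clauses power_divide)
  show thesis
  proof
    show "w = ((1/2) *\<^sub>R w + z) + ((1/2) *\<^sub>R w + - z)"
      by (simp flip: scaleR_left_distrib)
    show "norm ((1/2) *\<^sub>R w + z) = s" "norm ((1/2) *\<^sub>R w + - z) = s"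
      using sq s by (metis norm_ge_zero power2_eq_iff_nonneg)+
  qed
qed

text \<open>Linearity carries transitivity from the unit sphere to spheres of any positive
  radius.\<close>

lemma transitive_on_sphere_norm_eq:
  fixes u v :: "real^'n"
  assumes trans: "transitive_on_sphere K \<rho>" and uv: "norm u = norm v" "v \<noteq> 0"
  obtains k where "k \<in> carrier K" "\<rho> k *v u = v"
proof -
  have "(1 / norm v) *\<^sub>R u \<in> sphere 0 1" "(1 / norm v) *\<^sub>R v \<in> sphere 0 1"
    using uv by auto
  then obtain k where k: "k \<in> carrier K" "\<rho> k *v ((1 / norm v) *\<^sub>R u) = (1 / norm v) *\<^sub>R v"
    using trans unfolding transitive_on_sphere_def by blast
  then have "(1 / norm v) *\<^sub>R (\<rho> k *v u) = (1 / norm v) *\<^sub>R v"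
    by (simp add: matrix_vector_mult_scaleR)
  then show thesis
    using that[OF k(1)] uv(2) by simp
qed

text \<open>The cylinder over the ball is compact, and it is closed because its second factor is the
  whole space; closedness is not inferred from compactness, since \<open>T\<close> may fail to be
  Hausdorff. Used contrapositively: a sublevel set witnessing non-properness has unbounded first
  components.\<close>

lemma closure_of_bounded_fst_compact:
  fixes S :: "('v::euclidean_space \<times> 'k) set"
  assumes "compact_space T" and sub: "S \<subseteq> cball 0 R \<times> topspace T"
  shows "compactin (prod_topology euclidean T)
    (Abstract_Topology.closure_of (prod_topology euclidean T) S)"
proof (rule closed_compactin)
  let ?P = "prod_topology euclidean T :: ('v \<times> 'k) topology"
  show "compactin ?P (cball (0::'v) R \<times> topspace T)"
    using assms(1) by (simp add: compactin_Times compact_space_def)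
  have "closedin ?P (cball (0::'v) R \<times> topspace T)"
    by (simp add: closedin_prod_Times_iff)
  then show "Abstract_Topology.closure_of ?P S \<subseteq> cball (0::'v) R \<times> topspace T"
    by (rule closure_of_minimal[OF sub])
qed simp

theorem proposition1p8:
  fixes K :: "('k, 'm) monoid_scheme"
    and T :: "'k topology"
    and \<rho> :: "'k \<Rightarrow> real^'n^'n"
  assumes "CARD('n) \<ge> 2"
    and "compact_group K T"
    and "continuous_orthogonal_rep K T \<rho>"
    and "transitive_on_sphere K \<rho>"
  shows "strong_property_PL (semidirect K \<rho>) (semidirect_topology T)"
  unfolding strong_property_PL_def
proof (intro allI impI)
  fix L :: "(real^'n) \<times> 'k \<Rightarrow> real"
  assume L: "semigroup_length (semidirect K \<rho>) (semidirect_topology T) L"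
  interpret K: compact_group K T by (rule assms(2))
  interpret G: locally_compact_group "semidirect K \<rho>" "semidirect_topology T"
    by (rule locally_compact_group_semidirect[OF assms(2,3)])
  let ?e = "\<one>\<^bsub>K\<^esub>"
  have \<rho>_one: "\<rho> ?e *v v = v" for v
    using G.l_one[of "(v, ?e)"] by (simp add: semidirect_def)
  have sub: "L (v + \<rho> g *v w, g \<otimes>\<^bsub>K\<^esub> h) \<le> L (v, g) + L (w, h)"
    if "g \<in> carrier K" "h \<in> carrier K" for v w g h
    using L that by (force simp: semigroup_length_def semidirect_def)
  have nonneg: "0 \<le> L (v, g)" if "g \<in> carrier K" for v g
    using L that by (simp add: semigroup_length_def semidirect_def)
  have "compactin (semidirect_topology T) ({0} \<times> carrier K)"
    using K.compact
    by (simp add: semidirect_topology_def compactin_Times compact_space_def K.topspace_eq)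
  then have "bounded (L ` ({0} \<times> carrier K))"
    using L unfolding semigroup_length_def by blast
  then obtain C where "\<forall>x\<in>L ` ({0} \<times> carrier K). norm x \<le> C"
    by (auto simp: bounded_iff)
  then have C: "L (0, k) \<le> C" if "k \<in> carrier K" for k
    using that by fastforce
  \<comment> \<open>Factor \<open>(v, g)\<close> as \<open>(v, 1)\<close> times
    \<open>(0, g)\<close>; for \<open>lower\<close>, factor \<open>(v, 1)\<close> as
    \<open>(v, g)\<close> times the inverse of \<open>(0, g)\<close>.\<close>
  have upper: "L (v, g) \<le> L (v, ?e) + C" if "g \<in> carrier K" for v g
    using sub[of ?e g v 0] C[OF that] that by simp
  have lower: "L (v, ?e) \<le> L (v, g) + C" if "g \<in> carrier K" for v g
    using sub[of g "inv\<^bsub>K\<^esub> g" v 0] C[of "inv\<^bsub>K\<^esub> g"] that by simp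
  \<comment> \<open>The product of \<open>(0, k)\<close> and \<open>(v, 1)\<close> has second
    component \<open>k\<close>, which \<open>lower\<close> removes: each of the two moves costs
    \<open>C\<close>.\<close>
  have rotate: "L (\<rho> k *v v, ?e) \<le> L (v, ?e) + 2 * C" if "k \<in> carrier K" for k v
    using sub[of k ?e 0 v] C[OF that] lower[OF that, of "\<rho> k *v v"] that by simp
  show "bounded_length (semidirect K \<rho>) L \<or> proper_length (semidirect K \<rho>) (semidirect_topology T) L"
  proof (rule disjCI)
    assume "\<not> proper_length (semidirect K \<rho>) (semidirect_topology T) L"
    then obtain r where r: "\<not> compactin (semidirect_topology T) (Abstract_Topology.closure_of
        (semidirect_topology T) {x \<in> carrier (semidirect K \<rho>). L x \<in> {0..r}})"
      unfolding proper_length_def by blast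
    have unbounded: "\<exists>v. R < norm v \<and> L (v, ?e) \<le> r + C" for R
    proof -
      have "\<not> {x \<in> carrier (semidirect K \<rho>). L x \<in> {0..r}} \<subseteq> cball 0 R \<times> topspace T"
        using r closure_of_bounded_fst_compact[OF K.compact]
        unfolding semidirect_topology_def by blast
      then obtain v g where "R < norm v" "g \<in> carrier K" "L (v, g) \<le> r"
        by (auto simp: semidirect_def K.topspace_eq subset_iff not_le)
      then show ?thesis
        using lower[of g v] by fastforce
    qed
    have bound: "L (w, ?e) \<le> 2 * (r + 3 * C)" for w
    proof -
      \<comment> \<open>The strict inequality forces \<open>norm v\<close> to be positive, so the
        vectors \<open>c\<close> below are nonzero, as the transitivity lemma requires.\<close>
      obtain v where v: "norm w < norm v" "L (v, ?e) \<le> r + C"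
        using unbounded by blast
      have "norm w \<le> 2 * norm v"
        using v(1) norm_ge_zero[of v] by linarith
      then obtain a b where ab: "w = a + b" "norm a = norm v" "norm b = norm v"
        using sum_of_two_vectors_of_norm[of w "norm v"] assms(1) by auto
      \<comment> \<open>Here \<open>r + C\<close> comes from the choice of \<open>v\<close> and
        \<open>2 * C\<close> from rotating \<open>v\<close> to \<open>c\<close>.\<close>
      have "L (c, ?e) \<le> r + 3 * C" if c: "norm c = norm v" for c
      proof -
        have "c \<noteq> 0"
          using c v(1) norm_ge_zero[of w] by auto
        then obtain k where k: "k \<in> carrier K" "\<rho> k *v v = c"
          using transitive_on_sphere_norm_eq[OF assms(4)] c by metis
        show ?thesis
          using rotate[OF k(1), of v] k(2) v(2) by simp
      qed
      from this[OF ab(2)] this[OF ab(3)] show ?thesis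
        using sub[of ?e ?e a b] ab(1) by (simp add: \<rho>_one)
    qed
    have "norm (L (v, g)) \<le> 2 * (r + 3 * C) + C" if "g \<in> carrier K" for v g
      using nonneg[OF that, of v] upper[OF that, of v] bound[of v] by simp
    then show "bounded_length (semidirect K \<rho>) L"
      unfolding bounded_length_def bounded_iff by (auto simp: semidirect_def)
  qed
qed

end
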